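(* Let $\alpha,\beta\in(0,\infty]$ and let $a:=\alpha^{-1}$, $b:=\beta^{-1}$ (with $\infty^{-1}=0$). Let $(i,j)$ be a non-diagonal box, i.e. $i,j\ge1$ and $i+j\le n$. The probabilities that this box of the random $\alpha/\beta$-staircase tableau $S_{n,\alpha,\beta}$ contains $\alpha$ or $\beta$ are $$\mathbb P\bigl(S_{n,\alpha,\beta}(i,j)=\alpha\bigr)=\frac{j-1+b}{(i+j+a+b-1)(i+j+a+b-2)},$$ $$\mathbb P\bigl(S_{n,\alpha,\beta}(i,j)=\beta\bigr)=\frac{i-1+a}{(i+j+a+b-1)(i+j+a+b-2)},$$ and thus $$\mathbb P\bigl(S_{n,\alpha,\beta}(i,j)\ne0\bigr)=\frac{1}{i+j+a+b-1}.$$ For $\alpha=\beta=\infty$ and $i=j=1$, the right-hand sides of the first two formulas are interpreted as $1/2$.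
   Context: An $\alpha/\beta$-staircase tableau of size $n\ge1$ is a filling of the Young diagram of shape $(n,n-1,\dots,2,1)$, whose boxes are $(i,j)$ (row $i$ from the top, column $j$ from the left) with $i,j\ge1$, $i+j\le n+1$, such that: each box is empty or contains one of the symbols $\alpha,\beta$; no diagonal box (box with $i+j=n+1$) is empty; all boxes in the same row and to the left of a $\beta$ are empty; all boxes in the same column and above an $\alpha$ are empty. Let $\bar{\mathcal S}_n$ be the set of these tableaux. For $S\in\bar{\mathcal S}_n$ let $N_\alpha(S),N_\beta(S)$ be the numbers of symbols $\alpha$ and $\beta$ in $S$, and let $S(i,j)$ be the symbol in box $(i,j)$, with $S(i,j)=0$ if the box is empty. For parameter values $\alpha,\beta\in(0,\infty)$, $S_{n,\alpha,\beta}$ is the random element of $\bar{\mathcal S}_n$ with $\mathbb P(S_{n,\alpha,\beta}=S)=\alpha^{N_\alpha(S)}\beta^{N_\beta(S)}/Z_n(\alpha,\beta)$, where $Z_n(\alpha,\beta)=\sum_{S\in\bar{\mathcal S}_n}\alpha^{N_\alpha(S)}\beta^{N_\beta(S)}$. If exactly one of $\alpha,\beta$ is $\infty$, the distribution is the limit of this one as that parameter tends to $\infty$ with the other fixed; if $\alpha=\beta=\infty$, it is the limit as $\alpha=\beta\to\infty$. *)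

theory Defs
  imports "HOL-Probability.Probability"
begin

datatype symbol = Alpha | Beta

text \<open>
  A filling maps boxes (row, column), both counted from 1, to their content, with \<open>None\<close> for
  an empty box.  It is required to be \<open>None\<close> outside the diagram, so that tableaux of size \<open>n\<close>
  correspond one-to-one to elements of \<open>tableaux n\<close>.
\<close>

type_synonym filling = "nat \<times> nat \<Rightarrow> symbol option"

definition boxes :: "nat \<Rightarrow> (nat \<times> nat) set" where
  "boxes n = {(i, j). 1 \<le> i \<and> 1 \<le> j \<and> i + j \<le> n + 1}"

definition tableaux :: "nat \<Rightarrow> filling set" where
  "tableaux n = {S.
     (\<forall>c. c \<notin> boxes n \<longrightarrow> S c = None) \<and>
     (\<forall>i j. (i, j) \<in> boxes n \<and> i + j = n + 1 \<longrightarrow> S (i, j) \<noteq> None) \<and>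
     (\<forall>i j k. S (i, j) = Some Beta \<and> k < j \<longrightarrow> S (i, k) = None) \<and>
     (\<forall>i j k. S (i, j) = Some Alpha \<and> k < i \<longrightarrow> S (k, j) = None)}"

definition num_symbol :: "symbol \<Rightarrow> nat \<Rightarrow> filling \<Rightarrow> nat" where
  "num_symbol s n S = card {c \<in> boxes n. S c = Some s}"

definition weight :: "nat \<Rightarrow> real \<Rightarrow> real \<Rightarrow> filling \<Rightarrow> real" where
  "weight n x y S = x ^ num_symbol Alpha n S * y ^ num_symbol Beta n S"

definition partition_fun :: "nat \<Rightarrow> real \<Rightarrow> real \<Rightarrow> real" where
  "partition_fun n x y = (\<Sum>S\<in>tableaux n. weight n x y S)"

text \<open>Meaningful for positive \<open>x\<close> and \<open>y\<close>, see \<open>pmf_tableau_pmf_fin\<close>.\<close>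

definition tableau_pmf_fin :: "nat \<Rightarrow> real \<Rightarrow> real \<Rightarrow> filling pmf" where
  "tableau_pmf_fin n x y =
     embed_pmf (\<lambda>S. if S \<in> tableaux n then weight n x y S / partition_fun n x y else 0)"

text \<open>
  The limit of distributions on a discrete space.  All distributions below live on the finite set
  \<open>tableaux n\<close>, so that convergence in distribution is convergence of the point masses.
\<close>

definition is_pmf_limit :: "('t \<Rightarrow> 'a pmf) \<Rightarrow> 't filter \<Rightarrow> 'a pmf \<Rightarrow> bool" where
  "is_pmf_limit p F q \<longleftrightarrow> (\<forall>x. ((\<lambda>t. pmf (p t) x) \<longlongrightarrow> pmf q x) F)"

definition pmf_limit :: "('t \<Rightarrow> 'a pmf) \<Rightarrow> 't filter \<Rightarrow> 'a pmf" where
  "pmf_limit p F = (THE q. is_pmf_limit p F q)"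

definition tableau_pmf :: "nat \<Rightarrow> ereal \<Rightarrow> ereal \<Rightarrow> filling pmf" where
  "tableau_pmf n \<alpha> \<beta> =
     (if \<alpha> = \<infinity> \<and> \<beta> = \<infinity> then pmf_limit (\<lambda>t. tableau_pmf_fin n t t) at_top
      else if \<alpha> = \<infinity> then pmf_limit (\<lambda>t. tableau_pmf_fin n t (real_of_ereal \<beta>)) at_top
      else if \<beta> = \<infinity> then pmf_limit (\<lambda>t. tableau_pmf_fin n (real_of_ereal \<alpha>) t) at_top
      else tableau_pmf_fin n (real_of_ereal \<alpha>) (real_of_ereal \<beta>))"

text \<open>The definitions are meaningful: the normalisation is positive and the limits exist.\<close>

lemma finite_boxes: "finite (boxes n)"
  by (rule finite_subset[of _ "{..n} \<times> {..n}"]) (auto simp: boxes_def)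

lemma finite_tableaux: "finite (tableaux n)"
proof (rule finite_subset)
  let ?F = "{S. \<forall>c. (c \<in> boxes n \<longrightarrow> S c \<in> {None, Some Alpha, Some Beta}) \<and>
      (c \<notin> boxes n \<longrightarrow> S c = None)}"
  have "v \<in> {None, Some Alpha, Some Beta}" for v
    by (cases v; simp; metis symbol.exhaust)
  then show "tableaux n \<subseteq> ?F"
    unfolding tableaux_def by blast
  show "finite ?F"
    by (rule finite_set_of_finite_funs[OF finite_boxes]) simp
qed

lemma tableaux_nonempty: "tableaux n \<noteq> {}"
proof -
  have "(\<lambda>(i, j). if (i, j) \<in> boxes n \<and> i + j = n + 1 then Some Alpha else None) \<in> tableaux n"
    by (auto simp: tableaux_def)
  then show ?thesis by blast
qed

lemma weight_pos: "x > 0 \<Longrightarrow> y > 0 \<Longrightarrow> weight n x y S > 0"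
  by (simp add: weight_def)

lemma partition_fun_pos: "x > 0 \<Longrightarrow> y > 0 \<Longrightarrow> partition_fun n x y > 0"
  unfolding partition_fun_def
  by (intro sum_pos finite_tableaux tableaux_nonempty weight_pos)

lemma pmf_embed_finite:
  fixes f :: "'a \<Rightarrow> real"
  assumes "finite A" "\<And>x. x \<in> A \<Longrightarrow> f x \<ge> 0" "(\<Sum>x\<in>A. f x) = 1"
  shows "pmf (embed_pmf (\<lambda>x. if x \<in> A then f x else 0)) x = (if x \<in> A then f x else 0)"
proof (rule pmf_embed_pmf)
  show "0 \<le> (if x \<in> A then f x else 0)" for x using assms(2) by simp
  have "(\<integral>\<^sup>+x. ennreal (if x \<in> A then f x else 0) \<partial>count_space UNIV) =
        (\<Sum>x\<in>A. ennreal (if x \<in> A then f x else 0))"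
    by (rule nn_integral_count_space') (use assms in auto)
  also have "\<dots> = (\<Sum>x\<in>A. ennreal (f x))" by (rule sum.cong) auto
  also have "\<dots> = 1" using assms by (subst sum_ennreal) auto
  finally show "(\<integral>\<^sup>+x. ennreal (if x \<in> A then f x else 0) \<partial>count_space UNIV) = 1" .
qed

lemma pmf_tableau_pmf_fin:
  assumes "x > 0" "y > 0"
  shows "pmf (tableau_pmf_fin n x y) S =
    (if S \<in> tableaux n then weight n x y S / partition_fun n x y else 0)"
  unfolding tableau_pmf_fin_def
proof (rule pmf_embed_finite[OF finite_tableaux])
  show "weight n x y S / partition_fun n x y \<ge> 0" for S
    using weight_pos[OF assms, of n S] partition_fun_pos[OF assms, of n] by simp
  show "(\<Sum>S\<in>tableaux n. weight n x y S / partition_fun n x y) = 1"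
    using partition_fun_pos[OF assms, of n]
    by (simp add: partition_fun_def flip: sum_divide_distrib)
qed

lemma pmf_limit_eqI:
  assumes "is_pmf_limit p F q" "F \<noteq> bot"
  shows "pmf_limit p F = q"
  unfolding pmf_limit_def
proof (rule the_equality[where P = "is_pmf_limit p F", OF assms(1)])
  fix r assume "is_pmf_limit p F r"
  with assms show "r = q"
    unfolding is_pmf_limit_def by (metis pmf_eqI tendsto_unique)
qed

lemma power_ratio_tendsto:
  fixes k :: "'a \<Rightarrow> nat" and c :: "'a \<Rightarrow> real"
  assumes "finite A" "A \<noteq> {}" "\<And>x. x \<in> A \<Longrightarrow> c x > 0"
  shows "\<exists>l. \<forall>x\<in>A. ((\<lambda>t. c x * t ^ k x / (\<Sum>z\<in>A. c z * t ^ k z)) \<longlongrightarrow> l x) at_top"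
proof -
  define m where "m = Max (k ` A)"
  have le: "k x \<le> m" if "x \<in> A" for x using assms that by (auto simp: m_def)
  define d where "d x = (if k x = m then c x else 0)" for x
  have "m \<in> k ` A" unfolding m_def using assms by (intro Max_in) auto
  then obtain x0 where x0: "x0 \<in> A" "k x0 = m" by auto
  have dpos: "(\<Sum>z\<in>A. d z) > 0"
    using x0 assms by (intro sum_pos2[of _ x0]) (auto simp: d_def less_imp_le)
  have lim: "((\<lambda>t. c x * (t ^ k x / t ^ m)) \<longlongrightarrow> d x) at_top" if "x \<in> A" for x
  proof (cases "k x = m")
    case True
    have "eventually (\<lambda>t::real. c x * (t ^ k x / t ^ m) = d x) at_top"
      using eventually_gt_at_top[of 0] by eventually_elim (simp add: True d_def)
    then show ?thesis by (rule tendsto_eventually)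
  next
    case False
    with le[OF that] have lt: "k x < m" by simp
    have "((\<lambda>t::real. c x * inverse (t ^ (m - k x))) \<longlongrightarrow> c x * 0) at_top"
      by (intro tendsto_intros tendsto_inverse_0_at_top filterlim_pow_at_top filterlim_ident)
        (use lt in auto)
    moreover have "eventually (\<lambda>t::real. c x * inverse (t ^ (m - k x)) = c x * (t ^ k x / t ^ m)) at_top"
      using eventually_gt_at_top[of 0]
      by eventually_elim (use lt in \<open>simp add: power_diff field_simps\<close>)
    ultimately show ?thesis using False
      by (simp add: d_def) (rule Lim_transform_eventually)
  qed
  show ?thesis
  proof (intro exI ballI)
    fix x assume x: "x \<in> A"
    have "((\<lambda>t. c x * (t ^ k x / t ^ m) / (\<Sum>z\<in>A. c z * (t ^ k z / t ^ m)))
        \<longlongrightarrow> d x / (\<Sum>z\<in>A. d z)) at_top"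
      using dpos by (intro tendsto_divide tendsto_sum lim x) auto
    moreover have "eventually (\<lambda>t::real. c x * (t ^ k x / t ^ m) / (\<Sum>z\<in>A. c z * (t ^ k z / t ^ m))
        = c x * t ^ k x / (\<Sum>z\<in>A. c z * t ^ k z)) at_top"
      using eventually_gt_at_top[of 0]
      by eventually_elim (simp flip: sum_divide_distrib)
    ultimately show "((\<lambda>t. c x * t ^ k x / (\<Sum>z\<in>A. c z * t ^ k z)) \<longlongrightarrow> d x / (\<Sum>z\<in>A. d z)) at_top"
      by (rule Lim_transform_eventually)
  qed
qed

lemma pmf_limit_exists:
  fixes p :: "real \<Rightarrow> filling pmf" and f g :: "real \<Rightarrow> real"
  assumes p: "\<And>t. p t = tableau_pmf_fin n (f t) (g t)"
    and fg: "\<And>t. t > 0 \<Longrightarrow> f t > 0 \<and> g t > 0"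
    and w: "\<And>t S. weight n (f t) (g t) S = c S * t ^ k S"
    and c: "\<And>S. c S > 0"
  shows "is_pmf_limit p at_top (pmf_limit p at_top)"
proof -
  let ?r = "\<lambda>S t. c S * t ^ k S / (\<Sum>T\<in>tableaux n. c T * t ^ k T)"
  obtain l where l: "\<And>S. S \<in> tableaux n \<Longrightarrow> (?r S \<longlongrightarrow> l S) at_top"
    using power_ratio_tendsto[OF finite_tableaux tableaux_nonempty, of n c k] c by blast
  have pm: "eventually (\<lambda>t. (if S \<in> tableaux n then ?r S t else 0) = pmf (p t) S) at_top" for S
    using eventually_gt_at_top[of 0]
    by eventually_elim (use fg in \<open>simp add: p pmf_tableau_pmf_fin partition_fun_def w\<close>)
  have lim: "((\<lambda>t. pmf (p t) S) \<longlongrightarrow> (if S \<in> tableaux n then l S else 0)) at_top" for S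
    by (rule Lim_transform_eventually[OF _ pm]) (auto intro: l)
  have nonneg: "l S \<ge> 0" if "S \<in> tableaux n" for S
    using lim[of S] that by (auto intro: tendsto_lowerbound)
  have "((\<lambda>t. \<Sum>S\<in>tableaux n. pmf (p t) S) \<longlongrightarrow> (\<Sum>S\<in>tableaux n. l S)) at_top"
    using lim by (intro tendsto_sum) (metis (full_types))
  moreover have "eventually (\<lambda>t. (\<Sum>S\<in>tableaux n. pmf (p t) S) = 1) at_top"
    using eventually_gt_at_top[of 0]
  proof eventually_elim
    case (elim t)
    then show ?case
      using partition_fun_pos[of "f t" "g t" n] fg[OF elim]
      by (simp add: p pmf_tableau_pmf_fin flip: sum_divide_distrib)
        (simp add: partition_fun_def)
  qed
  ultimately have "(\<Sum>S\<in>tableaux n. l S) = 1"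
    by (metis tendsto_eventually tendsto_unique trivial_limit_at_top_linorder)
  then have "is_pmf_limit p at_top (embed_pmf (\<lambda>S. if S \<in> tableaux n then l S else 0))"
    unfolding is_pmf_limit_def
    using lim by (simp add: pmf_embed_finite[OF finite_tableaux nonneg])
  then show ?thesis
    by (subst pmf_limit_eqI) (auto intro: trivial_limit_at_top_linorder)
qed

lemma tableau_pmf_fin_limits:
  assumes "x > 0"
  shows "is_pmf_limit (\<lambda>t. tableau_pmf_fin n t t) at_top
      (pmf_limit (\<lambda>t. tableau_pmf_fin n t t) at_top)"
    and "is_pmf_limit (\<lambda>t. tableau_pmf_fin n t x) at_top
      (pmf_limit (\<lambda>t. tableau_pmf_fin n t x) at_top)"
    and "is_pmf_limit (\<lambda>t. tableau_pmf_fin n x t) at_top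
      (pmf_limit (\<lambda>t. tableau_pmf_fin n x t) at_top)"
proof -
  show "is_pmf_limit (\<lambda>t. tableau_pmf_fin n t t) at_top
      (pmf_limit (\<lambda>t. tableau_pmf_fin n t t) at_top)"
    by (rule pmf_limit_exists[where f = "\<lambda>t. t" and g = "\<lambda>t. t" and c = "\<lambda>_. 1"
        and k = "\<lambda>S. num_symbol Alpha n S + num_symbol Beta n S"])
      (auto simp: weight_def power_add)
  show "is_pmf_limit (\<lambda>t. tableau_pmf_fin n t x) at_top
      (pmf_limit (\<lambda>t. tableau_pmf_fin n t x) at_top)"
    by (rule pmf_limit_exists[where f = "\<lambda>t. t" and g = "\<lambda>_. x"
        and c = "\<lambda>S. x ^ num_symbol Beta n S" and k = "num_symbol Alpha n"])
      (use assms in \<open>auto simp: weight_def\<close>)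
  show "is_pmf_limit (\<lambda>t. tableau_pmf_fin n x t) at_top
      (pmf_limit (\<lambda>t. tableau_pmf_fin n x t) at_top)"
    by (rule pmf_limit_exists[where f = "\<lambda>_. x" and g = "\<lambda>t. t"
        and c = "\<lambda>S. x ^ num_symbol Alpha n S" and k = "num_symbol Beta n"])
      (use assms in \<open>auto simp: weight_def\<close>)
qed

end

theory Submission
  imports Defs
begin

text \<open>
  Let \<open>x\<close> and \<open>y\<close> be the finite parameters and \<open>a\<close> and \<open>b\<close> their inverses.  A \<open>Beta\<close> has only empty
  boxes to its left, so each row contains at most one, and the probability of a \<open>Beta\<close> in box \<open>(i, j)\<close>
  is the difference of the probabilities that row \<open>i\<close> has a \<open>Beta\<close> in the columns from \<open>j\<close> on and
  from \<open>j + 1\<close> on.  Two facts give these probabilities.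

  The first is that the random tableau without its top row is again a random tableau, of size
  smaller by one and with \<open>a\<close> replaced by \<open>a + 1\<close>.  Given the rest \<open>T\<close>, the top row is described by
  an arbitrary set of columns in which \<open>T\<close> has no \<open>Alpha\<close>, to be occupied besides the diagonal box,
  and by the symbol in the leftmost occupied box; every other occupied box must contain \<open>Alpha\<close>.
  The weights of these top rows add up to \<open>(x + y) * (1 + x) ^ c\<close>, where \<open>c\<close> is the number of columns
  of \<open>T\<close> without \<open>Alpha\<close>.  Since \<open>c\<close> is the size of \<open>T\<close> minus its number of \<open>Alpha\<close>s, the factor
  \<open>(1 + x) ^ c\<close> amounts, up to normalisation, to replacing \<open>x\<close> by \<open>x / (1 + x)\<close>, that is, \<open>a\<close> by
  \<open>a + 1\<close> (\<open>sum_fibre\<close>, \<open>map_drop_row_tableau_pmf\<close>).  Transposing a tableau and exchanging the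
  symbols exchanges \<open>a\<close> and \<open>b\<close>, so removing the first column replaces \<open>b\<close> by \<open>b + 1\<close>.

  The second is that the top row has a \<open>Beta\<close> with probability \<open>y / (x + y) = a / (a + b)\<close>: the
  symbol in its leftmost occupied box is chosen freely (\<open>prob_Beta_in_top_row\<close>).

  Removing \<open>j - 1\<close> columns and \<open>i - 1\<close> rows, a \<open>Beta\<close> occurs in row \<open>i\<close> in the columns from \<open>j\<close> on
  with probability \<open>(a + i - 1) / (a + b + i + j - 2)\<close>, and the formula for \<open>Beta\<close> follows by
  subtraction.  The formula for \<open>Alpha\<close> is its transpose, and infinite parameters are handled by
  passing to the limit.
\<close>

section \<open>Weights as products over boxes\<close>

definition entry_weight :: "real \<Rightarrow> real \<Rightarrow> symbol option \<Rightarrow> real" where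
  "entry_weight x y v = (case v of None \<Rightarrow> 1 | Some Alpha \<Rightarrow> x | Some Beta \<Rightarrow> y)"

lemma entry_weight_simps [simp]:
  "entry_weight x y None = 1" "entry_weight x y (Some Alpha) = x" "entry_weight x y (Some Beta) = y"
  by (simp_all add: entry_weight_def)

lemma content_cases:
  obtains "v = None" | "v = Some Alpha" | "v = Some Beta"
  by (metis option.exhaust symbol.exhaust)

lemma weight_eq_prod: "weight n x y S = (\<Prod>c\<in>boxes n. entry_weight x y (S c))"
proof -
  have e: "entry_weight x y v = (if v = Some Alpha then x else 1) * (if v = Some Beta then y else 1)"
    for v by (cases v rule: content_cases) auto
  show ?thesis
    unfolding weight_def num_symbol_def e prod.distrib prod.inter_filter[OF finite_boxes, symmetric]
    by simp
qed

lemma prod_boxes_Suc: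
  "(\<Prod>c\<in>boxes (Suc n). f c) = (\<Prod>j = 1..Suc n. f (1, j)) * (\<Prod>(i, j)\<in>boxes n. f (Suc i, j))"
proof -
  let ?g = "\<lambda>(i, j). (Suc i, j :: nat)"
  have split: "boxes (Suc n) = Pair 1 ` {1..Suc n} \<union> ?g ` boxes n"
  proof (intro equalityI subsetI)
    fix c assume "c \<in> boxes (Suc n)"
    then obtain i j where c: "c = (i, j)" "1 \<le> i" "1 \<le> j" "i + j \<le> Suc n + 1"
      by (auto simp: boxes_def)
    show "c \<in> Pair 1 ` {1..Suc n} \<union> ?g ` boxes n"
    proof (cases "i = 1")
      case True
      then show ?thesis using c by auto
    next
      case False
      then have "(i - 1, j) \<in> boxes n" "c = ?g (i - 1, j)" using c by (auto simp: boxes_def)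
      then show ?thesis by blast
    qed
  qed (auto simp: boxes_def)
  have inj: "inj_on (Pair 1) {1..Suc n}" "inj_on ?g (boxes n)"
    by (auto simp: inj_on_def)
  have "(\<Prod>c\<in>boxes (Suc n). f c) = prod f (Pair 1 ` {1..Suc n}) * prod f (?g ` boxes n)"
    unfolding split
    by (rule prod.union_disjoint) (auto simp: finite_boxes intro!: finite_imageI, auto simp: boxes_def)
  then show ?thesis
    unfolding prod.reindex[OF inj(1)] prod.reindex[OF inj(2)] by (simp add: o_def case_prod_unfold)
qed

section \<open>Adding and removing a top row\<close>

text \<open>
  Shifting alone would move the old top row to row 0, which must be empty in a tableau.
\<close>

definition drop_row :: "filling \<Rightarrow> filling" where
  "drop_row S = (\<lambda>(i, j). if i = 0 then None else S (Suc i, j))"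

definition add_row :: "filling \<Rightarrow> symbol \<Rightarrow> nat set \<Rightarrow> filling" where
  "add_row T s B = (\<lambda>(i, j). case i of 0 \<Rightarrow> None
     | Suc 0 \<Rightarrow> (if j \<in> B then Some (if j = Min B then s else Alpha) else None)
     | Suc (Suc k) \<Rightarrow> T (Suc k, j))"

definition free_columns :: "nat \<Rightarrow> filling \<Rightarrow> nat set" where
  "free_columns n T = {j \<in> {1..n}. \<forall>i. T (i, j) \<noteq> Some Alpha}"

lemma add_row_simps [simp]:
  "add_row T s B (0, j) = None"
  "add_row T s B (Suc 0, j) = (if j \<in> B then Some (if j = Min B then s else Alpha) else None)"
  "add_row T s B (Suc (Suc k), j) = T (Suc k, j)"
  by (simp_all add: add_row_def)

lemma row_cases:
  fixes i :: nat
  obtains "i = 0" | "i = Suc 0" | k where "i = Suc (Suc k)"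
  by (metis nat.exhaust)

lemma finite_subset_free_columns: "B \<subseteq> free_columns n T \<Longrightarrow> finite B"
  by (rule finite_subset[of _ "{1..n}"]) (auto simp: free_columns_def)

lemma tableaux_outside: "S \<in> tableaux n \<Longrightarrow> (i, j) \<notin> boxes n \<Longrightarrow> S (i, j) = None"
  unfolding tableaux_def by blast

lemma tableaux_diagonal: "S \<in> tableaux n \<Longrightarrow> (i, j) \<in> boxes n \<Longrightarrow> i + j = n + 1 \<Longrightarrow> S (i, j) \<noteq> None"
  unfolding tableaux_def by blast

lemma tableaux_Beta: "S \<in> tableaux n \<Longrightarrow> S (i, j) = Some Beta \<Longrightarrow> k < j \<Longrightarrow> S (i, k) = None"
  unfolding tableaux_def by blast

lemma tableaux_Alpha: "S \<in> tableaux n \<Longrightarrow> S (i, j) = Some Alpha \<Longrightarrow> k < i \<Longrightarrow> S (k, j) = None"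
  unfolding tableaux_def by blast

lemma tableaux_in_boxes: "S \<in> tableaux n \<Longrightarrow> S (i, j) = Some v \<Longrightarrow> (i, j) \<in> boxes n"
  using tableaux_outside by fastforce

lemma drop_row_in_tableaux:
  assumes S: "S \<in> tableaux (Suc n)"
  shows "drop_row S \<in> tableaux n"
  unfolding tableaux_def
proof (intro CollectI conjI allI impI)
  fix c assume "c \<notin> boxes n"
  then show "drop_row S c = None"
    using tableaux_outside[OF S, of "Suc (fst c)" "snd c"]
    by (auto simp: drop_row_def boxes_def split: prod.splits)
next
  fix i j assume "(i, j) \<in> boxes n \<and> i + j = n + 1"
  then show "drop_row S (i, j) \<noteq> None"
    using tableaux_diagonal[OF S, of "Suc i" j] by (auto simp: drop_row_def boxes_def)
next
  fix i j k assume "drop_row S (i, j) = Some Beta \<and> k < j"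
  then show "drop_row S (i, k) = None"
    using tableaux_Beta[OF S, of "Suc i" j k] by (auto simp: drop_row_def split: if_splits)
next
  fix i j k assume "drop_row S (i, j) = Some Alpha \<and> k < i"
  then show "drop_row S (k, j) = None"
    using tableaux_Alpha[OF S, of "Suc i" j "Suc k"] by (auto simp: drop_row_def split: if_splits)
qed

lemma drop_row_add_row:
  assumes "T \<in> tableaux n"
  shows "drop_row (add_row T s B) = T"
proof
  fix c show "drop_row (add_row T s B) c = T c"
    using tableaux_outside[OF assms, of 0 "snd c"]
    by (cases c; cases "fst c") (auto simp: drop_row_def boxes_def)
qed

lemma add_row_in_tableaux:
  assumes T: "T \<in> tableaux n" and B: "B \<subseteq> free_columns n T"
  shows "add_row T s (insert (Suc n) B) \<in> tableaux (Suc n)"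
  unfolding tableaux_def
proof (intro CollectI conjI allI impI)
  let ?B = "insert (Suc n) B" let ?S = "add_row T s ?B"
  have fin: "finite ?B" and sub: "?B \<subseteq> {1..Suc n}"
    using B finite_subset_free_columns[OF B] by (auto simp: free_columns_def)
  have free: "T (i, j) \<noteq> Some Alpha" if "j \<in> ?B" for i j
    using that B tableaux_in_boxes[OF T, of i j Alpha] by (auto simp: free_columns_def boxes_def)
  show "?S c = None" if "c \<notin> boxes (Suc n)" for c
  proof -
    obtain i j where c: "c = (i, j)" by (cases c)
    consider "i = 0" | "i = Suc 0" | k where "i = Suc (Suc k)" by (rule row_cases)
    then show ?thesis
    proof cases
      case 3
      then show ?thesis using that tableaux_outside[OF T, of "Suc k" j] by (auto simp: c boxes_def)
    qed (use that sub in \<open>auto simp: c boxes_def\<close>)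
  qed
  show "?S (i, j) \<noteq> None" if diag: "(i, j) \<in> boxes (Suc n) \<and> i + j = Suc n + 1" for i j
  proof -
    consider "i = Suc 0" | k where "i = Suc (Suc k)"
      using diag by (cases i rule: row_cases) (auto simp: boxes_def)
    then show ?thesis
    proof cases
      case 2
      then show ?thesis
        using that tableaux_diagonal[OF T, of "Suc k" j] by (auto simp: boxes_def)
    qed (use that in auto)
  qed
  show "?S (i, k) = None" if "?S (i, j) = Some Beta \<and> k < j" for i j k
  proof -
    consider "i = 0" | "i = Suc 0" | l where "i = Suc (Suc l)" by (rule row_cases)
    then show ?thesis
    proof cases
      case 2
      then have "j = Min ?B" using that by (auto split: if_splits)
      then have "k \<notin> ?B" using that fin by (metis Min_le not_le)
      then show ?thesis using 2 by simp
    next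
      case 3
      then show ?thesis using that tableaux_Beta[OF T, of "Suc l" j k] by auto
    qed simp
  qed
  show "?S (k, j) = None" if "?S (i, j) = Some Alpha \<and> k < i" for i j k
  proof -
    consider "i \<le> Suc 0" | l where "i = Suc (Suc l)"
      by (cases i rule: row_cases) auto
    then show ?thesis
    proof cases
      case 1
      then show ?thesis using that by (cases k) auto
    next
      case 2
      then have a: "T (Suc l, j) = Some Alpha" using that by simp
      then have "j \<notin> ?B" using free by metis
      consider "k = 0" | "k = Suc 0" | m where "k = Suc (Suc m)" by (rule row_cases)
      then show ?thesis
      proof cases
        case 2
        then show ?thesis using \<open>j \<notin> ?B\<close> by simp
      next
        case 3
        then show ?thesis using that 2 tableaux_Alpha[OF T a, of "Suc m"] by simp
      qed simp
    qed
  qed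
qed

text \<open>
  In a row of a tableau a \<open>Beta\<close> is the leftmost entry.  So the top row is determined by its set of
  nonempty boxes, which besides the diagonal box are arbitrary free columns, and by the symbol in
  the leftmost of them.
\<close>

lemma bij_betw_add_row:
  assumes T: "T \<in> tableaux n"
  shows "bij_betw (\<lambda>(B, s). add_row T s (insert (Suc n) B)) (Pow (free_columns n T) \<times> UNIV)
    {S \<in> tableaux (Suc n). drop_row S = T}"
proof (intro bij_betw_imageI)
  let ?f = "\<lambda>(B, s). add_row T s (insert (Suc n) B)"
  show "inj_on ?f (Pow (free_columns n T) \<times> UNIV)"
  proof (rule inj_onI, clarify)
    fix B s C t
    assume BC: "B \<subseteq> free_columns n T" "C \<subseteq> free_columns n T"
      and eq: "add_row T s (insert (Suc n) B) = add_row T t (insert (Suc n) C)"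
    have top: "add_row T s (insert (Suc n) B) (Suc 0, j) = add_row T t (insert (Suc n) C) (Suc 0, j)"
      for j by (simp only: eq)
    have "j \<in> insert (Suc n) B \<longleftrightarrow> j \<in> insert (Suc n) C" for j
      using top[of j] unfolding add_row_simps by (metis option.distinct(1))
    then have ins: "insert (Suc n) B = insert (Suc n) C" by blast
    moreover have "Suc n \<notin> B" "Suc n \<notin> C" using BC by (auto simp: free_columns_def)
    ultimately have "B = C" by (metis insert_ident)
    have "finite (insert (Suc n) B)"
      using finite_subset_free_columns[OF BC(1)] by simp
    then have "Min (insert (Suc n) B) \<in> insert (Suc n) B" by (intro Min_in) auto
    then have "s = t" using top[of "Min (insert (Suc n) B)"] by (simp only: add_row_simps ins) simp
    then show "B = C \<and> s = t" using \<open>B = C\<close> by simp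
  qed
  show "?f ` (Pow (free_columns n T) \<times> UNIV) = {S \<in> tableaux (Suc n). drop_row S = T}"
  proof (intro equalityI subsetI)
    fix S assume "S \<in> ?f ` (Pow (free_columns n T) \<times> UNIV)"
    then show "S \<in> {S \<in> tableaux (Suc n). drop_row S = T}"
      using add_row_in_tableaux[OF T] drop_row_add_row[OF T] by auto
  next
    fix S assume "S \<in> {S \<in> tableaux (Suc n). drop_row S = T}"
    then have S: "S \<in> tableaux (Suc n)" and dT: "drop_row S = T" by auto
    define C where "C = {j. S (Suc 0, j) \<noteq> None}"
    define B where "B = C - {Suc n}"
    define s where "s = the (S (Suc 0, Min C))"
    have sub: "C \<subseteq> {1..Suc n}" using tableaux_in_boxes[OF S] by (force simp: C_def boxes_def)
    then have fin: "finite C" by (rule finite_subset) simp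
    have diag: "Suc n \<in> C" using tableaux_diagonal[OF S, of "Suc 0" "Suc n"] by (simp add: C_def boxes_def)
    then have C: "C = insert (Suc n) B" by (auto simp: B_def)
    have Min: "Min C \<in> C" using fin diag by (intro Min_in) auto
    have "B \<subseteq> free_columns n T"
    proof
      fix j assume j: "j \<in> B"
      have "T (i, j) \<noteq> Some Alpha" for i
      proof
        assume "T (i, j) = Some Alpha"
        then have "S (Suc i, j) = Some Alpha" "i > 0"
          by (auto simp: dT[symmetric] drop_row_def split: if_splits)
        then have "S (Suc 0, j) = None" using tableaux_Alpha[OF S] by simp
        then show False using j by (simp add: B_def C_def)
      qed
      then show "j \<in> free_columns n T" using j sub by (fastforce simp: free_columns_def B_def)
    qed
    moreover have "S (i, j) = add_row T s C (i, j)" for i j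
    proof -
      consider "i = 0" | "i = Suc 0" | k where "i = Suc (Suc k)" by (rule row_cases)
      then show ?thesis
      proof cases
        case 1
        then show ?thesis using tableaux_outside[OF S, of 0 j] by (simp add: boxes_def)
      next
        case 2
        have "S (Suc 0, j) = Some Alpha" if j: "j \<in> C" "j \<noteq> Min C"
        proof (rule ccontr)
          assume "S (Suc 0, j) \<noteq> Some Alpha"
          with j have "S (Suc 0, j) = Some Beta"
            by (auto simp: C_def) (metis symbol.exhaust)
          moreover have "Min C < j" using j fin by (simp add: order_less_le)
          ultimately have "S (Suc 0, Min C) = None" using tableaux_Beta[OF S] by blast
          then show False using Min by (simp add: C_def)
        qed
        moreover have "S (Suc 0, Min C) = Some s" using Min by (auto simp: C_def s_def)
        ultimately show ?thesis using 2 by (auto simp: C_def)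
      next
        case 3
        then show ?thesis by (simp add: dT[symmetric] drop_row_def)
      qed
    qed
    ultimately show "S \<in> ?f ` (Pow (free_columns n T) \<times> UNIV)"
      by (intro image_eqI[of _ _ "(B, s)"]) (auto simp: C)
  qed
qed

lemma weight_add_row:
  assumes T: "T \<in> tableaux n" and B: "B \<subseteq> free_columns n T"
  shows "weight (Suc n) x y (add_row T s (insert (Suc n) B)) =
    weight n x y T * x ^ card B * entry_weight x y (Some s)"
proof -
  let ?B = "insert (Suc n) B" let ?S = "add_row T s ?B"
  have fin: "finite B" and sub: "?B \<subseteq> {1..Suc n}" and new: "Suc n \<notin> B"
    using B finite_subset_free_columns[OF B] by (auto simp: free_columns_def)
  have Min: "Min ?B \<in> ?B" using fin by (intro Min_in) auto
  have "(\<Prod>j = 1..Suc n. entry_weight x y (?S (1, j))) = (\<Prod>j\<in>?B. entry_weight x y (?S (1, j)))"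
    by (rule prod.mono_neutral_right) (use sub in auto)
  also have "\<dots> = entry_weight x y (?S (1, Min ?B)) * (\<Prod>j\<in>?B - {Min ?B}. entry_weight x y (?S (1, j)))"
    using fin Min by (intro prod.remove) auto
  also have "(\<Prod>j\<in>?B - {Min ?B}. entry_weight x y (?S (1, j))) = (\<Prod>j\<in>?B - {Min ?B}. x)"
    by (rule prod.cong) auto
  also have "\<dots> = x ^ card B"
    using fin new Min by simp
  also have "?S (1, Min ?B) = Some s" using Min by simp
  finally have row: "(\<Prod>j = 1..Suc n. entry_weight x y (?S (1, j))) =
    entry_weight x y (Some s) * x ^ card B" .
  have "(\<Prod>(i, j)\<in>boxes n. entry_weight x y (?S (Suc i, j))) = weight n x y T"
    unfolding weight_eq_prod
  proof (rule prod.cong, goal_cases)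
    case (2 c)
    then show ?case by (cases c; cases "fst c") (auto simp: boxes_def)
  qed simp
  then show ?thesis
    unfolding weight_eq_prod[of "Suc n"] prod_boxes_Suc row by simp
qed

text \<open>Every column holds at most one \<open>Alpha\<close>.\<close>

lemma num_Alpha_plus_free_columns:
  assumes T: "T \<in> tableaux n"
  shows "num_symbol Alpha n T + card (free_columns n T) = n"
proof -
  let ?A = "{c \<in> boxes n. T c = Some Alpha}"
  have "inj_on snd ?A"
  proof (rule inj_onI, clarify)
    fix i j i' j' assume "T (i, j) = Some Alpha" "T (i', j') = Some Alpha" "snd (i, j) = snd (i', j')"
    then show "i = i' \<and> j = j'"
      using tableaux_Alpha[OF T, of i j i'] tableaux_Alpha[OF T, of i' j i]
      by (cases i i' rule: linorder_cases) auto
  qed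
  then have "num_symbol Alpha n T = card (snd ` ?A)"
    by (simp add: num_symbol_def card_image)
  moreover have "{1..n} = snd ` ?A \<union> free_columns n T"
    using tableaux_in_boxes[OF T] by (fastforce simp: free_columns_def boxes_def image_iff)
  moreover have "snd ` ?A \<inter> free_columns n T = {}" by (auto simp: free_columns_def)
  moreover have "finite (snd ` ?A)" "finite (free_columns n T)"
    by (auto simp: finite_boxes free_columns_def)
  ultimately show ?thesis by (metis card_Un_disjoint card_atLeastAtMost diff_Suc_1)
qed

lemma sum_Pow_power_card:
  fixes x :: real
  assumes "finite A"
  shows "(\<Sum>B\<in>Pow A. x ^ card B) = (1 + x) ^ card A"
  using prod_add[OF assms, of "\<lambda>_. x" "\<lambda>_. 1"] by (simp add: add.commute)

lemma UNIV_symbol: "UNIV = {Alpha, Beta}"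
  using symbol.exhaust by blast

text \<open>
  Summing over the set of occupied free columns gives \<open>(1 + x) ^ c\<close> for the \<open>c\<close> free columns of \<open>T\<close>.
  It can be absorbed into the weight of \<open>T\<close> by changing \<open>x\<close>, because \<open>c\<close> and the number of \<open>Alpha\<close>s
  in \<open>T\<close> add up to \<open>n\<close>.  The function \<open>f\<close> is meant to be the indicator of an event that, over \<open>T\<close>,
  depends only on the symbol in the leftmost nonempty box of the top row.
\<close>

lemma sum_fibre:
  assumes T: "T \<in> tableaux n" and x: "x > 0"
    and f: "\<And>B s. B \<subseteq> free_columns n T \<Longrightarrow> f (add_row T s (insert (Suc n) B)) = g s"
  shows "(\<Sum>S | S \<in> tableaux (Suc n) \<and> drop_row S = T. f S * weight (Suc n) x y S) =
    (g Alpha * x + g Beta * y) * (1 + x) ^ n * weight n (x / (1 + x)) y T"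
proof -
  let ?C = "free_columns n T"
  have fin: "finite ?C" by (simp add: free_columns_def)
  have "(\<Sum>S | S \<in> tableaux (Suc n) \<and> drop_row S = T. f S * weight (Suc n) x y S) =
    (\<Sum>(B, s)\<in>Pow ?C \<times> UNIV. f (add_row T s (insert (Suc n) B)) *
      weight (Suc n) x y (add_row T s (insert (Suc n) B)))"
    by (subst sum.reindex_bij_betw[OF bij_betw_add_row[OF T], symmetric])
      (simp add: case_prod_unfold)
  also have "\<dots> = (\<Sum>(B, s)\<in>Pow ?C \<times> UNIV. weight n x y T * x ^ card B * (g s * entry_weight x y (Some s)))"
    by (rule sum.cong) (auto simp: f weight_add_row[OF T])
  also have "\<dots> = (\<Sum>B\<in>Pow ?C. (g Alpha * x + g Beta * y) * weight n x y T * x ^ card B)"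
    by (subst sum.cartesian_product[symmetric], rule sum.cong)
      (auto simp: UNIV_symbol algebra_simps)
  also have "\<dots> = (g Alpha * x + g Beta * y) * ((1 + x) ^ card ?C * weight n x y T)"
    by (simp add: sum_Pow_power_card[OF fin] flip: sum_distrib_left)
  also have "(1 + x) ^ card ?C * weight n x y T = (1 + x) ^ n * weight n (x / (1 + x)) y T"
  proof -
    have "(1 + x) ^ n = (1 + x) ^ num_symbol Alpha n T * (1 + x) ^ card ?C"
      using num_Alpha_plus_free_columns[OF T] by (metis power_add)
    then show ?thesis using x by (simp add: weight_def power_divide)
  qed
  finally show ?thesis by simp
qed

lemma sum_tableaux_Suc:
  "(\<Sum>S\<in>tableaux (Suc n). f S) =
    (\<Sum>T\<in>tableaux n. \<Sum>S | S \<in> tableaux (Suc n) \<and> drop_row S = T. f S)"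
  by (rule sum.group[OF finite_tableaux finite_tableaux, symmetric])
    (rule image_subsetI, rule drop_row_in_tableaux)

lemma partition_fun_Suc:
  assumes "x > 0"
  shows "partition_fun (Suc n) x y = (x + y) * (1 + x) ^ n * partition_fun n (x / (1 + x)) y"
proof -
  have "partition_fun (Suc n) x y = (\<Sum>S\<in>tableaux (Suc n). 1 * weight (Suc n) x y S)"
    by (simp add: partition_fun_def)
  also have "\<dots> = (\<Sum>T\<in>tableaux n. (x + y) * (1 + x) ^ n * weight n (x / (1 + x)) y T)"
    unfolding sum_tableaux_Suc
  proof (rule sum.cong[OF refl])
    fix T assume T: "T \<in> tableaux n"
    show "(\<Sum>S | S \<in> tableaux (Suc n) \<and> drop_row S = T. 1 * weight (Suc n) x y S) =
        (x + y) * (1 + x) ^ n * weight n (x / (1 + x)) y T"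
      using sum_fibre[OF T assms, of "\<lambda>_. 1" "\<lambda>_. 1" y] by simp
  qed
  finally show ?thesis by (simp add: partition_fun_def sum_distrib_left)
qed

section \<open>The random tableau with finite parameters\<close>

lemma set_tableau_pmf_fin: "x > 0 \<Longrightarrow> y > 0 \<Longrightarrow> set_pmf (tableau_pmf_fin n x y) \<subseteq> tableaux n"
  by (auto simp: set_pmf_eq pmf_tableau_pmf_fin)

lemma prob_finite_support:
  assumes "finite A" "set_pmf p \<subseteq> A"
  shows "measure_pmf.prob p E = (\<Sum>x\<in>A \<inter> E. pmf p x)"
proof -
  have "measure_pmf.prob p E = measure_pmf.prob p (A \<inter> E)"
    by (rule measure_pmf.finite_measure_eq_AE) (use assms in \<open>auto simp: AE_measure_pmf_iff\<close>)
  then show ?thesis using assms by (simp add: measure_measure_pmf_finite)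
qed

lemma prob_tableau_pmf_fin:
  assumes "x > 0" "y > 0"
  shows "measure_pmf.prob (tableau_pmf_fin n x y) E =
    (\<Sum>S\<in>tableaux n. indicator E S * weight n x y S) / partition_fun n x y"
proof -
  have "measure_pmf.prob (tableau_pmf_fin n x y) E =
      (\<Sum>S\<in>tableaux n \<inter> E. weight n x y S / partition_fun n x y)"
    unfolding prob_finite_support[OF finite_tableaux set_tableau_pmf_fin[OF assms]]
    by (rule sum.cong) (auto simp: pmf_tableau_pmf_fin[OF assms])
  also have "\<dots> = (\<Sum>S\<in>tableaux n. indicator E S * weight n x y S) / partition_fun n x y"
    unfolding sum.inter_restrict[OF finite_tableaux] sum_divide_distrib
    by (rule sum.cong) auto
  finally show ?thesis .
qed

text \<open>
  By \<open>sum_fibre\<close>, the total weight above \<open>T\<close> is the new weight of \<open>T\<close> times a factor that does not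
  depend on \<open>T\<close> and cancels in the normalisation.
\<close>

lemma map_drop_row_tableau_pmf:
  assumes x: "x > 0" and y: "y > 0"
  shows "map_pmf drop_row (tableau_pmf_fin (Suc n) x y) = tableau_pmf_fin n (x / (1 + x)) y"
proof (rule pmf_eqI)
  fix T
  have x': "x / (1 + x) > 0" using x by simp
  have Z: "partition_fun n (x / (1 + x)) y > 0" by (rule partition_fun_pos[OF x' y])
  have "pmf (map_pmf drop_row (tableau_pmf_fin (Suc n) x y)) T =
    (\<Sum>S\<in>tableaux (Suc n). indicator (drop_row -` {T}) S * weight (Suc n) x y S) / partition_fun (Suc n) x y"
    by (simp add: pmf_map prob_tableau_pmf_fin[OF x y])
  also have "(\<Sum>S\<in>tableaux (Suc n). indicator (drop_row -` {T}) S * weight (Suc n) x y S) =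
      (\<Sum>U\<in>tableaux n. of_bool (U = T) * ((x + y) * (1 + x) ^ n * weight n (x / (1 + x)) y U))"
    unfolding sum_tableaux_Suc
  proof (rule sum.cong[OF refl])
    fix U assume U: "U \<in> tableaux n"
    have "indicator (drop_row -` {T}) (add_row U s (insert (Suc n) B)) = (of_bool (U = T) :: real)"
      if "B \<subseteq> free_columns n U" for B s
      using drop_row_add_row[OF U] by (simp add: indicator_def)
    from sum_fibre[OF U x, of "indicator (drop_row -` {T})" "\<lambda>_. of_bool (U = T)" y, OF this]
    show "(\<Sum>S | S \<in> tableaux (Suc n) \<and> drop_row S = U.
          indicator (drop_row -` {T}) S * weight (Suc n) x y S) =
        of_bool (U = T) * ((x + y) * (1 + x) ^ n * weight n (x / (1 + x)) y U)"
      by (simp add: algebra_simps)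
  qed
  also have "\<dots> = (if T \<in> tableaux n then (x + y) * (1 + x) ^ n * weight n (x / (1 + x)) y T else 0)"
    by (simp add: of_bool_def if_distrib[of "\<lambda>u. u * _"] sum.delta finite_tableaux cong: if_cong)
  finally show "pmf (map_pmf drop_row (tableau_pmf_fin (Suc n) x y)) T =
      pmf (tableau_pmf_fin n (x / (1 + x)) y) T"
    using x y Z by (simp add: pmf_tableau_pmf_fin[OF x' y] partition_fun_Suc)
qed

text \<open>
  Changing the leftmost symbol of the top row from \<open>Alpha\<close> to \<open>Beta\<close> turns the tableaux without a
  \<open>Beta\<close> in that row bijectively into those that have one, and multiplies the weight by \<open>y / x\<close>.
\<close>

lemma prob_Beta_in_top_row:
  assumes x: "x > 0" and y: "y > 0"
  shows "measure_pmf.prob (tableau_pmf_fin (Suc n) x y) {S. \<exists>k>0. S (Suc 0, k) = Some Beta} = y / (x + y)"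
proof -
  let ?E = "{S :: filling. \<exists>k>0. S (Suc 0, k) = Some Beta}"
  have x': "x / (1 + x) > 0" using x by simp
  have Z: "partition_fun n (x / (1 + x)) y > 0" by (rule partition_fun_pos[OF x' y])
  have "(\<Sum>S\<in>tableaux (Suc n). indicator ?E S * weight (Suc n) x y S) =
      (\<Sum>T\<in>tableaux n. y * (1 + x) ^ n * weight n (x / (1 + x)) y T)"
    unfolding sum_tableaux_Suc
  proof (rule sum.cong[OF refl])
    fix T assume T: "T \<in> tableaux n"
    have "indicator ?E (add_row T s (insert (Suc n) B)) = (of_bool (s = Beta) :: real)"
      if B: "B \<subseteq> free_columns n T" for B s
    proof -
      let ?B = "insert (Suc n) B"
      have "finite ?B" "?B \<subseteq> {1..Suc n}"
        using finite_subset_free_columns[OF B] B by (auto simp: free_columns_def)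
      then have Min: "Min ?B \<in> ?B" and "Min ?B \<in> {1..Suc n}"
        by (metis Min_in insert_not_empty, metis Min_in insert_not_empty subsetD)
      have "add_row T s ?B \<in> ?E \<longleftrightarrow> s = Beta"
      proof
        assume "add_row T s ?B \<in> ?E"
        then show "s = Beta" by (auto split: if_splits)
      next
        assume "s = Beta"
        then have "add_row T s ?B (Suc 0, Min ?B) = Some Beta"
          unfolding add_row_simps using Min by simp
        moreover have "Min ?B > 0"
          using \<open>Min ?B \<in> {1..Suc n}\<close> by (simp only: atLeastAtMost_iff) linarith
        ultimately show "add_row T s ?B \<in> ?E" by blast
      qed
      then show ?thesis by (simp add: indicator_def)
    qed
    from sum_fibre[OF T x, of "indicator ?E" "\<lambda>s. of_bool (s = Beta)" y, OF this]
    show "(\<Sum>S | S \<in> tableaux (Suc n) \<and> drop_row S = T. indicator ?E S * weight (Suc n) x y S) =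
        y * (1 + x) ^ n * weight n (x / (1 + x)) y T"
      by simp
  qed
  also have "\<dots> = y * (1 + x) ^ n * partition_fun n (x / (1 + x)) y"
    by (simp add: partition_fun_def sum_distrib_left)
  finally show ?thesis
    using x y Z by (simp add: prob_tableau_pmf_fin partition_fun_Suc)
qed

section \<open>Transposition\<close>

fun swap_symbol :: "symbol \<Rightarrow> symbol" where
  "swap_symbol Alpha = Beta" | "swap_symbol Beta = Alpha"

text \<open>
  The reflection that makes every statement about rows and \<open>Beta\<close> one about columns and \<open>Alpha\<close>:
  the symbols have to be exchanged for the result to be a tableau.
\<close>

definition flip :: "filling \<Rightarrow> filling" where
  "flip S = (\<lambda>(i, j). map_option swap_symbol (S (j, i)))"

lemma swap_symbol_swap_symbol [simp]: "swap_symbol (swap_symbol s) = s"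
  by (cases s) auto

lemma swap_symbol_eq_iff [simp]:
  "swap_symbol s = Alpha \<longleftrightarrow> s = Beta" "swap_symbol s = Beta \<longleftrightarrow> s = Alpha"
  by (cases s; simp)+

lemma flip_flip [simp]: "flip (flip S) = S"
  by (auto simp: flip_def option.map_comp o_def option.map_ident)

lemma flip_in_tableaux: "S \<in> tableaux n \<Longrightarrow> flip S \<in> tableaux n"
proof -
  assume S: "S \<in> tableaux n"
  have mem: "(j, i) \<in> boxes n \<longleftrightarrow> (i, j) \<in> boxes n" for i j
    by (auto simp: boxes_def)
  show ?thesis
    unfolding tableaux_def
  proof (intro CollectI conjI allI impI)
    fix c assume "c \<notin> boxes n"
    then show "flip S c = None"
      using tableaux_outside[OF S, of "snd c" "fst c"] mem by (cases c) (simp add: flip_def)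
  next
    fix i j assume "(i, j) \<in> boxes n \<and> i + j = n + 1"
    then show "flip S (i, j) \<noteq> None"
      using tableaux_diagonal[OF S, of j i] mem by (auto simp: flip_def)
  next
    fix i j k assume "flip S (i, j) = Some Beta \<and> k < j"
    then show "flip S (i, k) = None"
      using tableaux_Alpha[OF S, of j i k] by (auto simp: flip_def)
  next
    fix i j k assume "flip S (i, j) = Some Alpha \<and> k < i"
    then show "flip S (k, j) = None"
      using tableaux_Beta[OF S, of j i k] by (auto simp: flip_def)
  qed
qed

lemma weight_flip: "weight n x y (flip S) = weight n y x S"
proof -
  have "entry_weight x y (map_option swap_symbol v) = entry_weight y x v" for v
    by (cases v rule: content_cases) auto
  then have "weight n x y (flip S) = (\<Prod>c\<in>boxes n. entry_weight y x (S (prod.swap c)))"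
    unfolding weight_eq_prod by (intro prod.cong) (auto simp: flip_def)
  also have "\<dots> = (\<Prod>c\<in>boxes n. entry_weight y x (S c))"
    by (rule prod.reindex_bij_witness[of _ prod.swap prod.swap]) (auto simp: boxes_def)
  finally show ?thesis by (simp add: weight_eq_prod)
qed

lemma map_flip_tableau_pmf:
  assumes "x > 0" "y > 0"
  shows "map_pmf flip (tableau_pmf_fin n x y) = tableau_pmf_fin n y x"
proof (rule pmf_eqI)
  fix S
  have "partition_fun n x y = partition_fun n y x"
    unfolding partition_fun_def
    by (rule sum.reindex_bij_witness[of _ flip flip]) (auto simp: flip_in_tableaux weight_flip)
  moreover have "flip -` {S} = {flip S}" by auto
  moreover have "flip S \<in> tableaux n \<longleftrightarrow> S \<in> tableaux n"
    using flip_in_tableaux flip_flip by metis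
  ultimately show "pmf (map_pmf flip (tableau_pmf_fin n x y)) S = pmf (tableau_pmf_fin n y x) S"
    by (simp add: pmf_map measure_pmf_single pmf_tableau_pmf_fin assms weight_flip)
qed

section \<open>The law in terms of the inverse parameters\<close>

abbreviation inv_law :: "nat \<Rightarrow> real \<Rightarrow> real \<Rightarrow> filling pmf" where
  "inv_law n a b \<equiv> tableau_pmf_fin n (inverse a) (inverse b)"

lemma map_drop_row_inv_law:
  assumes "a > 0" "b > 0"
  shows "map_pmf drop_row (inv_law (Suc n) a b) = inv_law n (a + 1) b"
proof -
  have "inverse a / (1 + inverse a) = inverse (a + 1)" using assms by (simp add: field_simps)
  then show ?thesis using assms by (simp add: map_drop_row_tableau_pmf)
qed

definition drop_column :: "filling \<Rightarrow> filling" where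
  "drop_column S = (\<lambda>(i, j). if j = 0 then None else S (i, Suc j))"

lemma drop_column_eq_flip: "drop_column S = flip (drop_row (flip S))"
  by (auto simp: drop_column_def drop_row_def flip_def option.map_comp o_def option.map_ident)

lemma map_drop_column_inv_law:
  assumes "a > 0" "b > 0"
  shows "map_pmf drop_column (inv_law (Suc n) a b) = inv_law n a (b + 1)"
proof -
  have "drop_column = flip \<circ> drop_row \<circ> flip"
    by (rule ext) (simp add: drop_column_eq_flip)
  then have "map_pmf drop_column (inv_law (Suc n) a b) =
      map_pmf flip (map_pmf drop_row (map_pmf flip (inv_law (Suc n) a b)))"
    by (simp add: pmf.map_comp comp_assoc)
  also have "\<dots> = inv_law n a (b + 1)"
    using assms by (simp add: map_flip_tableau_pmf map_drop_row_inv_law)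
  finally show ?thesis .
qed

text \<open>
  Here and below \<open>i\<close> and \<open>j\<close> count the rows above and the columns to the left of the region under
  consideration; these are removed one by one, and each removal adds 1 to \<open>a\<close> or to \<open>b\<close>.
\<close>

lemma prob_Beta_in_row:
  assumes "a > 0" "b > 0" "i < n"
  shows "measure_pmf.prob (inv_law n a b) {S. \<exists>k>0. S (Suc i, k) = Some Beta} =
    (a + real i) / (a + b + real i)"
  using assms
proof (induction i arbitrary: n a)
  case 0
  then obtain m where "n = Suc m" by (metis Suc_pred)
  then show ?case using 0 prob_Beta_in_top_row[of "inverse a" "inverse b" m]
    by (simp add: field_simps)
next
  case (Suc i)
  then obtain m where m: "n = Suc m" "i < m" by (cases n) auto
  have "{S. \<exists>k>0. S (Suc (Suc i), k) = Some Beta} = drop_row -` {S. \<exists>k>0. S (Suc i, k) = Some Beta}"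
    by (auto simp: drop_row_def)
  then have "measure_pmf.prob (inv_law n a b) {S. \<exists>k>0. S (Suc (Suc i), k) = Some Beta} =
      measure_pmf.prob (map_pmf drop_row (inv_law n a b)) {S. \<exists>k>0. S (Suc i, k) = Some Beta}"
    by simp
  also have "\<dots> = (a + 1 + real i) / (a + 1 + b + real i)"
    using Suc.prems Suc.IH[of "a + 1" m] m by (simp add: map_drop_row_inv_law)
  finally show ?case by (simp add: add_ac)
qed

lemma ex_greater_Suc: "(\<exists>k>Suc j. P k) \<longleftrightarrow> (\<exists>k>j. P (Suc k))"
  by (auto simp: Suc_less_eq2)

lemma ex_greater_eq_or_greater_Suc: "(\<exists>k>j. P k) \<longleftrightarrow> P (Suc j) \<or> (\<exists>k>Suc j. P k)"
  unfolding Suc_le_eq[symmetric, of j] le_less by auto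

lemma prob_Beta_in_row_right_of:
  assumes "a > 0" "b > 0" "i + j < n"
  shows "measure_pmf.prob (inv_law n a b) {S. \<exists>k>j. S (Suc i, k) = Some Beta} =
    (a + real i) / (a + b + real i + real j)"
  using assms
proof (induction j arbitrary: n b)
  case 0
  then show ?case using prob_Beta_in_row[of a b i n] by simp
next
  case (Suc j)
  then obtain m where m: "n = Suc m" "i + j < m" by (cases n) auto
  have "(\<exists>k>Suc j. S (Suc i, k) = Some Beta) \<longleftrightarrow> (\<exists>k>j. S (Suc i, Suc k) = Some Beta)" for S :: filling
    by (rule ex_greater_Suc)
  moreover have "(\<exists>k>j. S (Suc i, Suc k) = Some Beta) \<longleftrightarrow> (\<exists>k>j. drop_column S (Suc i, k) = Some Beta)"
    for S :: filling
    by (rule ex_cong1) (auto simp: drop_column_def)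
  ultimately have "{S. \<exists>k>Suc j. S (Suc i, k) = Some Beta} =
      drop_column -` {S. \<exists>k>j. S (Suc i, k) = Some Beta}"
    unfolding vimage_def by simp
  then have "measure_pmf.prob (inv_law n a b) {S. \<exists>k>Suc j. S (Suc i, k) = Some Beta} =
      measure_pmf.prob (map_pmf drop_column (inv_law n a b)) {S. \<exists>k>j. S (Suc i, k) = Some Beta}"
    by simp
  also have "\<dots> = (a + real i) / (a + (b + 1) + real i + real j)"
    using Suc.prems Suc.IH[of "b + 1" m] m by (simp add: map_drop_column_inv_law)
  finally show ?case by (simp add: add_ac)
qed

text \<open>
  A row contains at most one \<open>Beta\<close>, so the probability is a difference of two values of the previous
  lemma.  That lemma needs the box to the right to exist, which is where \<open>(i, j)\<close> must be off the
  diagonal.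
\<close>

lemma prob_Beta_inv_law:
  assumes ab: "a > 0" "b > 0" and ij: "Suc (i + j) < n"
  shows "measure_pmf.prob (inv_law n a b) {S. S (Suc i, Suc j) = Some Beta} =
    (a + real i) / ((a + b + real i + real j + 1) * (a + b + real i + real j))"
proof -
  let ?P = "measure_pmf.prob (inv_law n a b)"
  let ?here = "{S :: filling. S (Suc i, Suc j) = Some Beta}"
  let ?right = "{S :: filling. \<exists>k>Suc j. S (Suc i, k) = Some Beta}"
  have "(\<exists>k>j. S (Suc i, k) = Some Beta) \<longleftrightarrow> S \<in> ?here \<union> ?right" for S :: filling
    using ex_greater_eq_or_greater_Suc[of j "\<lambda>k. S (Suc i, k) = Some Beta"] by simp
  then have un: "{S. \<exists>k>j. S (Suc i, k) = Some Beta} = ?here \<union> ?right" by blast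
  have "AE S in inv_law n a b. S \<notin> ?here \<or> S \<notin> ?right"
    unfolding AE_measure_pmf_iff
  proof
    fix S assume "S \<in> set_pmf (inv_law n a b)"
    then have "S \<in> tableaux n"
      using set_tableau_pmf_fin[of "inverse a" "inverse b" n] ab by auto
    from tableaux_Beta[OF this, of "Suc i" _ "Suc j"] show "S \<notin> ?here \<or> S \<notin> ?right"
      by auto
  qed
  then have "?P (?here \<union> ?right) = ?P ?here + ?P ?right"
    by (intro measure_Un_AE) (simp_all add: measure_pmf.fmeasurable_eq_sets)
  moreover have "?P (?here \<union> ?right) = (a + real i) / (a + b + real i + real j)"
    unfolding un[symmetric] using ab ij by (intro prob_Beta_in_row_right_of) auto
  moreover have "?P ?right = (a + real i) / (a + b + real i + real (Suc j))"
    using ab ij by (intro prob_Beta_in_row_right_of) auto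
  moreover have "(a + real i) / (a + b + real i + real j) - (a + real i) / (a + b + real i + real (Suc j)) =
    (a + real i) / ((a + b + real i + real j + 1) * (a + b + real i + real j))"
  proof -
    have "u / v - u / (v + 1) = u / ((v + 1) * v)" if "v > 0" for u v :: real
      using that by (simp add: field_simps)
    from this[of "a + b + real i + real j" "a + real i"] show ?thesis
      using ab by (simp add: add_ac)
  qed
  ultimately show ?thesis by simp
qed

lemma prob_Alpha_inv_law:
  assumes ab: "a > 0" "b > 0" and ij: "Suc (i + j) < n"
  shows "measure_pmf.prob (inv_law n a b) {S. S (Suc i, Suc j) = Some Alpha} =
    (b + real j) / ((a + b + real i + real j + 1) * (a + b + real i + real j))"
proof -
  have "flip -` {S. S (Suc j, Suc i) = Some Beta} = {S. S (Suc i, Suc j) = Some Alpha}"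
    by (auto simp: flip_def)
  then have "measure_pmf.prob (inv_law n a b) {S. S (Suc i, Suc j) = Some Alpha} =
      measure_pmf.prob (map_pmf flip (inv_law n a b)) {S. S (Suc j, Suc i) = Some Beta}"
    by simp
  also have "\<dots> = (b + real j) / ((b + a + real j + real i + 1) * (b + a + real j + real i))"
    using ab ij by (simp add: map_flip_tableau_pmf prob_Beta_inv_law)
  finally show ?thesis by (simp add: add_ac)
qed

section \<open>Infinite parameters\<close>

text \<open>
  Convergence of the point masses gives convergence of probabilities because the supports lie in
  one finite set.
\<close>

lemma prob_tendsto_is_pmf_limit:
  assumes lim: "is_pmf_limit p F q" and "F \<noteq> bot" and A: "finite A"
    and supp: "eventually (\<lambda>t. set_pmf (p t) \<subseteq> A) F"
  shows "((\<lambda>t. measure_pmf.prob (p t) E) \<longlongrightarrow> measure_pmf.prob q E) F"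
proof -
  have "pmf q x = 0" if "x \<notin> A" for x
  proof (rule tendsto_unique[OF \<open>F \<noteq> bot\<close>])
    show "((\<lambda>t. pmf (p t) x) \<longlongrightarrow> pmf q x) F" using lim by (simp add: is_pmf_limit_def)
    show "((\<lambda>t. pmf (p t) x) \<longlongrightarrow> 0) F"
      by (rule tendsto_eventually, use supp in eventually_elim) (use that in \<open>auto simp: set_pmf_eq\<close>)
  qed
  then have "measure_pmf.prob q E = (\<Sum>x\<in>A \<inter> E. pmf q x)"
    by (intro prob_finite_support A) (auto simp: set_pmf_eq)
  moreover have "((\<lambda>t. \<Sum>x\<in>A \<inter> E. pmf (p t) x) \<longlongrightarrow> (\<Sum>x\<in>A \<inter> E. pmf q x)) F"
    using lim by (intro tendsto_sum) (simp add: is_pmf_limit_def)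
  moreover have "eventually (\<lambda>t. (\<Sum>x\<in>A \<inter> E. pmf (p t) x) = measure_pmf.prob (p t) E) F"
    using supp by eventually_elim (simp add: prob_finite_support[OF A])
  ultimately show ?thesis by (simp add: Lim_transform_eventually)
qed

text \<open>
  All four cases of the definition of the random tableau at once: in each of them it is a limit of
  laws with finite parameters, along a filter on which the inverse parameters tend to \<open>a\<close> and \<open>b\<close>.
  When both parameters are infinite, they are moreover equal, which selects the value \<open>1 / 2\<close>.
\<close>

lemma tableau_pmf_is_limit:
  fixes \<alpha> \<beta> :: ereal
  assumes pos: "\<alpha> > 0" "\<beta> > 0"
    and a: "a = real_of_ereal (inverse \<alpha>)" and b: "b = real_of_ereal (inverse \<beta>)"
  obtains f g :: "real \<Rightarrow> real" where
    "\<forall>t>0. f t > 0 \<and> g t > 0"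
    "(f \<longlongrightarrow> a) at_top" "(g \<longlongrightarrow> b) at_top"
    "is_pmf_limit (\<lambda>t. inv_law n (f t) (g t)) at_top (tableau_pmf n \<alpha> \<beta>)"
    "\<alpha> = \<infinity> \<and> \<beta> = \<infinity> \<longrightarrow> f = g"
proof -
  have inv0: "((\<lambda>t::real. inverse t) \<longlongrightarrow> 0) at_top"
    by (rule tendsto_inverse_0_at_top[OF filterlim_ident])
  have a0: "a = 0" if "\<alpha> = \<infinity>" using that a by simp
  have b0: "b = 0" if "\<beta> = \<infinity>" using that b by simp
  have ra: "a = inverse (real_of_ereal \<alpha>) \<and> real_of_ereal \<alpha> > 0" if "\<alpha> \<noteq> \<infinity>"
    using that pos a by (cases \<alpha>) auto
  have rb: "b = inverse (real_of_ereal \<beta>) \<and> real_of_ereal \<beta> > 0" if "\<beta> \<noteq> \<infinity>"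
    using that pos b by (cases \<beta>) auto
  consider "\<alpha> = \<infinity>" "\<beta> = \<infinity>" | "\<alpha> = \<infinity>" "\<beta> \<noteq> \<infinity>" | "\<alpha> \<noteq> \<infinity>" "\<beta> = \<infinity>" | "\<alpha> \<noteq> \<infinity>" "\<beta> \<noteq> \<infinity>"
    by blast
  then show ?thesis
  proof cases
    case 1
    show ?thesis
      by (rule that[of inverse inverse])
        (use 1 inv0 a0 b0 tableau_pmf_fin_limits(1)[of 1 n] in \<open>simp_all add: tableau_pmf_def\<close>)
  next
    case 2
    show ?thesis
      by (rule that[of inverse "\<lambda>_. b"])
        (use 2 inv0 a0 rb tableau_pmf_fin_limits(2)[of "real_of_ereal \<beta>" n]
          in \<open>simp_all add: tableau_pmf_def\<close>)
  next
    case 3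
    show ?thesis
      by (rule that[of "\<lambda>_. a" inverse])
        (use 3 inv0 b0 ra tableau_pmf_fin_limits(3)[of "real_of_ereal \<alpha>" n]
          in \<open>simp_all add: tableau_pmf_def\<close>)
  next
    case 4
    show ?thesis
      by (rule that[of "\<lambda>_. a" "\<lambda>_. b"])
        (use 4 ra rb in \<open>simp_all add: tableau_pmf_def is_pmf_limit_def\<close>)
  qed
qed

theorem theorem7p2:
  fixes \<alpha> \<beta> :: ereal and a b :: real and n i j :: nat
  assumes "\<alpha> > 0" and "\<beta> > 0"
    and "a = real_of_ereal (inverse \<alpha>)" and "b = real_of_ereal (inverse \<beta>)"
    and "n \<ge> 1" and "i \<ge> 1" and "j \<ge> 1" and "i + j \<le> n"
  shows "(measure_pmf.prob (tableau_pmf n \<alpha> \<beta>) {S. S (i, j) = Some Alpha} =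
      (if \<alpha> = \<infinity> \<and> \<beta> = \<infinity> \<and> i = 1 \<and> j = 1 then 1 / 2
       else (real j - 1 + b) / ((real i + real j + a + b - 1) * (real i + real j + a + b - 2)))) \<and>
     (measure_pmf.prob (tableau_pmf n \<alpha> \<beta>) {S. S (i, j) = Some Beta} =
      (if \<alpha> = \<infinity> \<and> \<beta> = \<infinity> \<and> i = 1 \<and> j = 1 then 1 / 2
       else (real i - 1 + a) / ((real i + real j + a + b - 1) * (real i + real j + a + b - 2)))) \<and>
     (measure_pmf.prob (tableau_pmf n \<alpha> \<beta>) {S. S (i, j) \<noteq> None} =
      1 / (real i + real j + a + b - 1))"
proof -
  let ?P = "measure_pmf.prob (tableau_pmf n \<alpha> \<beta>)"
  let ?special = "\<alpha> = \<infinity> \<and> \<beta> = \<infinity> \<and> i = 1 \<and> j = 1"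
  define D :: "real \<Rightarrow> real \<Rightarrow> real" where
    "D c d = (real i + real j + c + d - 1) * (real i + real j + c + d - 2)" for c d
  obtain f g :: "real \<Rightarrow> real" where fg: "\<forall>t>0. f t > 0 \<and> g t > 0"
    and fa: "(f \<longlongrightarrow> a) at_top" and gb: "(g \<longlongrightarrow> b) at_top"
    and lim: "is_pmf_limit (\<lambda>t. inv_law n (f t) (g t)) at_top (tableau_pmf n \<alpha> \<beta>)"
    and both: "\<alpha> = \<infinity> \<and> \<beta> = \<infinity> \<longrightarrow> f = g"
    using tableau_pmf_is_limit[OF assms(1-4), of n] by blast
  have supp: "eventually (\<lambda>t. set_pmf (inv_law n (f t) (g t)) \<subseteq> tableaux n) at_top"
    using eventually_gt_at_top[of 0] by eventually_elim (simp add: set_tableau_pmf_fin fg)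
  have P_lim: "((\<lambda>t. measure_pmf.prob (inv_law n (f t) (g t)) E) \<longlongrightarrow> ?P E) at_top" for E
    by (rule prob_tendsto_is_pmf_limit[OF lim _ finite_tableaux supp]) simp
  have P_eq: "?P E = l"
    if "eventually (\<lambda>t. measure_pmf.prob (inv_law n (f t) (g t)) E = h t) at_top"
      and "(h \<longlongrightarrow> l) at_top" for E h l
  proof (rule tendsto_unique[OF _ _ that(2)])
    show "(h \<longlongrightarrow> ?P E) at_top" by (rule Lim_transform_eventually[OF P_lim that(1)])
  qed simp
  have ev: "eventually (\<lambda>t. measure_pmf.prob (inv_law n (f t) (g t)) {S. S (i, j) = Some Alpha} =
        (real j - 1 + g t) / D (f t) (g t)) at_top"
    "eventually (\<lambda>t. measure_pmf.prob (inv_law n (f t) (g t)) {S. S (i, j) = Some Beta} =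
        (real i - 1 + f t) / D (f t) (g t)) at_top"
  proof -
    obtain i' j' where ij: "i = Suc i'" "j = Suc j'" "Suc (i' + j') < n"
      using assms(6-8) by (cases i; cases j) auto
    show "eventually (\<lambda>t. measure_pmf.prob (inv_law n (f t) (g t)) {S. S (i, j) = Some Alpha} =
        (real j - 1 + g t) / D (f t) (g t)) at_top"
      using eventually_gt_at_top[of 0]
      by eventually_elim (use fg ij prob_Alpha_inv_law in \<open>simp add: D_def add_ac\<close>)
    show "eventually (\<lambda>t. measure_pmf.prob (inv_law n (f t) (g t)) {S. S (i, j) = Some Beta} =
        (real i - 1 + f t) / D (f t) (g t)) at_top"
      using eventually_gt_at_top[of 0]
      by eventually_elim (use fg ij prob_Beta_inv_law in \<open>simp add: D_def add_ac\<close>)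
  qed
  have nonneg: "a \<ge> 0" "b \<ge> 0" using assms(1-4) by (cases \<alpha>; cases \<beta>; auto)+
  have pos: "a > 0 \<or> b > 0 \<or> i + j > 2" if "\<not> ?special"
    using that assms by (cases \<alpha>; cases \<beta>) auto
  have formula: "?P {S. S (i, j) = Some Alpha} = (if ?special then 1 / 2 else (real j - 1 + b) / D a b) \<and>
    ?P {S. S (i, j) = Some Beta} = (if ?special then 1 / 2 else (real i - 1 + a) / D a b)"
  proof (cases ?special)
    case True
    \<comment> \<open>Here the denominator tends to 0 as well, and the quotients become \<open>c / ((1 + 2 * c) * (2 * c))\<close> with
      \<open>c = f t = g t\<close>, where \<open>c\<close> cancels.\<close>
    then have "f = g" and a0: "a = 0" using both assms(3) by auto
    have half: "((\<lambda>t. 1 / (2 * (1 + 2 * f t))) \<longlongrightarrow> 1 / (2 * (1 + 2 * a))) at_top"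
      using nonneg by (intro tendsto_intros fa) auto
    have eq: "eventually (\<lambda>t. f t / D (f t) (g t) = 1 / (2 * (1 + 2 * f t))) at_top"
      using eventually_gt_at_top[of 0]
    proof eventually_elim
      case (elim t)
      then have "f t > 0" using fg by blast
      then show ?case using True by (simp add: D_def \<open>f = g\<close>[symmetric] divide_simps)
    qed
    have "((\<lambda>t. f t / D (f t) (g t)) \<longlongrightarrow> 1 / 2) at_top"
      by (rule Lim_transform_eventually[OF half[unfolded a0, simplified]])
        (use eq in \<open>eventually_elim, simp\<close>)
    then have "((\<lambda>t. (real j - 1 + g t) / D (f t) (g t)) \<longlongrightarrow> 1 / 2) at_top"
      and "((\<lambda>t. (real i - 1 + f t) / D (f t) (g t)) \<longlongrightarrow> 1 / 2) at_top"
      using True by (simp_all add: \<open>f = g\<close>)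
    then have "?P {S. S (i, j) = Some Alpha} = 1 / 2" "?P {S. S (i, j) = Some Beta} = 1 / 2"
      using P_eq[OF ev(1)] P_eq[OF ev(2)] by blast+
    then show ?thesis using True by simp
  next
    case False
    have D0: "D a b \<noteq> 0" using pos[OF False] nonneg assms(6,7) by (auto simp: D_def)
    have D_lim: "((\<lambda>t. D (f t) (g t)) \<longlongrightarrow> D a b) at_top"
      unfolding D_def by (intro tendsto_intros fa gb)
    have "((\<lambda>t. (real j - 1 + g t) / D (f t) (g t)) \<longlongrightarrow> (real j - 1 + b) / D a b) at_top"
      "((\<lambda>t. (real i - 1 + f t) / D (f t) (g t)) \<longlongrightarrow> (real i - 1 + a) / D a b) at_top"
      using D0 by (intro tendsto_intros fa gb D_lim; simp)+
    then have "?P {S. S (i, j) = Some Alpha} = (real j - 1 + b) / D a b"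
      "?P {S. S (i, j) = Some Beta} = (real i - 1 + a) / D a b"
      using P_eq[OF ev(1)] P_eq[OF ev(2)] by blast+
    then show ?thesis unfolding if_not_P[OF False] by blast
  qed
  have "v \<noteq> None \<longleftrightarrow> v = Some Alpha \<or> v = Some Beta" for v
    by (cases v rule: content_cases) auto
  then have "{S :: filling. S (i, j) \<noteq> None} = {S. S (i, j) = Some Alpha} \<union> {S. S (i, j) = Some Beta}"
    by auto
  then have "?P {S. S (i, j) \<noteq> None} = ?P {S. S (i, j) = Some Alpha} + ?P {S. S (i, j) = Some Beta}"
    by (simp only:) (rule measure_pmf.finite_measure_Union; auto)
  also have "\<dots> = 1 / (real i + real j + a + b - 1)"
  proof (cases ?special)
    case True
    then show ?thesis using formula assms(3,4) by simp
  next
    case False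
    have D0: "real i + real j + a + b - 2 \<noteq> 0"
      using pos[OF False] nonneg assms(6,7) by auto
    have "(real j - 1 + b) / D a b + (real i - 1 + a) / D a b = (real i + real j + a + b - 2) / D a b"
      by (simp add: add_divide_distrib[symmetric] algebra_simps)
    then show ?thesis
      using formula D0 unfolding if_not_P[OF False] by (simp add: D_def)
  qed
  finally show ?thesis using formula unfolding D_def by blast
qed

end
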